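(* Let $r_{k,m}$ be the number of plateau polycubes of width $k$ and lateral area $m$. For every integer $i\ge 0$, the quantity $r_{k,2k+i}$, for $k\geq i+1$, is given by a polynomial in $k$ of degree $i$ whose leading coefficient (the coefficient of $k^i$) is equal to $\dfrac{8^i}{i!}$.
   Context: A cell is a unit cube of the lattice $\mathbb{Z}^3$ with orthonormal coordinate system $(0,\vec i,\vec j,\vec k)$. A polycube is a finite (nonempty) union of cells, connected through their faces, and considered up to translation. Its width is the difference between its greatest and smallest indices (coordinates of its points) in the direction $\vec i$, i.e. the number of layers of cells it occupies in direction $\vec i$. A stratum is a polycube of width $1$; a plateau is a rectangular stratum (a full $1\times b\times c$ block of cells, of extent $1$ in direction $\vec i$). A plateau polycube is a polycube whose strata (its intersections with the successive unit-width layers orthogonal to $\vec i$) are all plateaus. The lateral area of a polycube is the sum of the areas (numbers of unit squares) of its projections onto the planes $(\vec i,\vec j)$ and $(\vec i,\vec k)$. *)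

theory Defs
  imports "HOL-Computational_Algebra.Polynomial" "HOL-Library.Product_Plus"
begin

text \<open>The triple \<open>(x, y, z)\<close> stands for the unit cube
  \<open>[x, x + 1] \<times> [y, y + 1] \<times> [z, z + 1]\<close>, and a union of cells is
  represented by the set of the cells it consists of. The first coordinate is the one along
  which width and strata are taken.\<close>

type_synonym cell = "int \<times> int \<times> int"

fun face_adjacent :: "cell \<Rightarrow> cell \<Rightarrow> bool" where
  "face_adjacent (x, y, z) (x', y', z') \<longleftrightarrow> \<bar>x - x'\<bar> + \<bar>y - y'\<bar> + \<bar>z - z'\<bar> = 1"

definition face_connected :: "cell set \<Rightarrow> bool" where
  "face_connected P \<longleftrightarrow>
     (\<forall>c\<in>P. \<forall>d\<in>P. (c, d) \<in> {(a, b). a \<in> P \<and> b \<in> P \<and> face_adjacent a b}\<^sup>*)"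

text \<open>A polycube at a fixed position; the identification of translates is made
  in \<open>num_plateau_polycubes\<close>.\<close>

definition polycube :: "cell set \<Rightarrow> bool" where
  "polycube P \<longleftrightarrow> finite P \<and> P \<noteq> {} \<and> face_connected P"

text \<open>The points of a cell with first index \<open>x\<close> have first coordinate ranging
  from \<open>x\<close> to \<open>x + 1\<close>, hence the \<open>+ 1\<close>.\<close>

definition width :: "cell set \<Rightarrow> nat" where
  "width P = nat ((Max (fst ` P) + 1) - Min (fst ` P))"

definition lateral_area :: "cell set \<Rightarrow> nat" where
  "lateral_area P = card ((\<lambda>(x, y, z). (x, y)) ` P) + card ((\<lambda>(x, y, z). (x, z)) ` P)"

definition stratum :: "cell set \<Rightarrow> bool" where
  "stratum S \<longleftrightarrow> polycube S \<and> width S = 1"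

definition plateau :: "cell set \<Rightarrow> bool" where
  "plateau S \<longleftrightarrow> stratum S \<and> (\<exists>x y y' z z'. S = {x} \<times> {y..y'} \<times> {z..z'})"

definition layer :: "int \<Rightarrow> cell set" where
  "layer x = {c. fst c = x}"

definition strata :: "cell set \<Rightarrow> cell set set" where
  "strata P = {P \<inter> layer x |x. P \<inter> layer x \<noteq> {}}"

definition plateau_polycube :: "cell set \<Rightarrow> bool" where
  "plateau_polycube P \<longleftrightarrow> polycube P \<and> (\<forall>S\<in>strata P. plateau S)"

definition translates :: "(cell set \<times> cell set) set" where
  "translates = {(P, Q). \<exists>v. Q = (+) v ` P}"

definition num_plateau_polycubes :: "nat \<Rightarrow> nat \<Rightarrow> nat" where
  "num_plateau_polycubes k m =
     card ({P. plateau_polycube P \<and> width P = k \<and> lateral_area P = m} // translates)"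

end

theory Submission
  imports Defs "HOL-Computational_Algebra.Formal_Power_Series"
begin

text \<open>
  A plateau polycube of width \<open>k\<close> is a stack of \<open>k\<close> rectangles such that consecutive
  rectangles overlap. Two rectangles overlap if and only if their sides do in each of the two
  directions, so the polycube is the same as a pair of independent chains of \<open>k\<close> intervals,
  consecutive ones overlapping, each chain considered up to translation. The lateral area is the sum
  of the lengths of all these intervals. It is at least \<open>2 * k\<close>, and if \<open>F k\<close>
  (below \<open>chain_fps k\<close>) is the generating function of chains by excess, which is total length
  minus \<open>k\<close>, then \<open>num_plateau_polycubes k (2 * k + i)\<close> is the coefficient of
  \<open>X ^ i\<close> in \<open>(F k)\<^sup>2\<close> (\<open>num_plateau_polycubes_eq_fps\<close>).

  An interval with \<open>b + 1\<close> cells can be placed in \<open>b + b' + 1\<close> positions so as to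
  overlap a given one with \<open>b' + 1\<close> cells. As this number is affine in \<open>b'\<close>, the series
  \<open>F k\<close>, together with the series weighted by the excess of the newest interval, satisfies a
  linear recurrence given by a two-by-two matrix. Its eigenvalues are the power series
  \<open>root_plus = 1 + 4 * X + ...\<close> and \<open>root_minus = - X + ...\<close>, and \<open>F k\<close> is a
  constant multiple of the difference of their \<open>k\<close>-th powers (\<open>chain_fps_closed\<close>;
  constant means independent of \<open>k\<close>). Since \<open>root_minus ^ k\<close> is divisible by
  \<open>X ^ k\<close>, for \<open>i < k\<close> the coefficient of \<open>X ^ i\<close> in \<open>(F k)\<^sup>2\<close> is that
  of \<open>E * (root_plus ^ 2) ^ k\<close> for a fixed series \<open>E\<close> with constant term 1
  (\<open>chain_fps_power2_nth\<close>).

  Finally, \<open>root_plus ^ 2 = 1 + 8 * X + ...\<close>, and by the binomial theorem the coefficient of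
  \<open>X ^ i\<close> in the \<open>k\<close>-th power of such a series is a polynomial in \<open>k\<close> with leading
  term \<open>8 ^ i * (k choose i)\<close>, that is, of degree \<open>i\<close> and with leading coefficient
  \<open>8 ^ i / fact i\<close> (\<open>fps_power_coeff_polynomial\<close>).
\<close>

section \<open>Stacks of rectangular blocks\<close>

type_synonym interval = "int \<times> int"

definition cells :: "interval \<Rightarrow> int set" where
  "cells p = {fst p..snd p}"

definition meets :: "interval \<Rightarrow> interval \<Rightarrow> bool" where
  "meets p q \<longleftrightarrow> cells p \<inter> cells q \<noteq> {}"

text \<open>One coordinate of a plateau polycube: the sides of its successive plateaus, which must
  overlap for consecutive plateaus to share a face.\<close>

definition chain :: "interval list \<Rightarrow> bool" where
  "chain ps \<longleftrightarrow> (\<forall>p\<in>set ps. fst p \<le> snd p) \<and> successively meets ps"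

text \<open>The amount by which the total number of unit cells exceeds its minimum, one per interval.\<close>

definition excess :: "interval list \<Rightarrow> nat" where
  "excess ps = (\<Sum>p\<leftarrow>ps. nat (snd p - fst p))"

lemma meets_iff:
  assumes "fst p \<le> snd p" "fst q \<le> snd q"
  shows "meets p q \<longleftrightarrow> fst p \<le> snd q \<and> fst q \<le> snd p"
  using assms by (auto simp: meets_def cells_def)

lemma chain_nth_le: "chain ps \<Longrightarrow> j < length ps \<Longrightarrow> fst (ps ! j) \<le> snd (ps ! j)"
  by (simp add: chain_def)

lemma chain_nth_meets: "chain ps \<Longrightarrow> Suc j < length ps \<Longrightarrow> meets (ps ! j) (ps ! Suc j)"
  by (simp add: chain_def successively_conv_nth)

definition block :: "int \<Rightarrow> interval \<Rightarrow> interval \<Rightarrow> cell set" where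
  "block x p q = {x} \<times> cells p \<times> cells q"

definition stack :: "interval list \<Rightarrow> interval list \<Rightarrow> cell set" where
  "stack ps qs = (\<Union>j<length ps. block (int j) (ps ! j) (qs ! j))"

lemma finite_block: "finite (block x p q)"
  by (simp add: block_def cells_def)

lemma finite_stack: "finite (stack ps qs)"
  by (simp add: stack_def finite_block)

lemma mem_stack:
  "(x, y, z) \<in> stack ps qs \<longleftrightarrow>
    0 \<le> x \<and> x < int (length ps) \<and> y \<in> cells (ps ! nat x) \<and> z \<in> cells (qs ! nat x)"
proof -
  have "(\<exists>j<n. x = int j \<and> Q j) \<longleftrightarrow> 0 \<le> x \<and> x < int n \<and> Q (nat x)" for n Q
    by (metis int_nat_eq nat_int nat_less_iff of_nat_0_le_iff)
  from this[of "length ps" "\<lambda>j. y \<in> cells (ps ! j) \<and> z \<in> cells (qs ! j)"] show ?thesis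
    unfolding stack_def block_def by auto
qed

lemma stack_layer: "j < length ps \<Longrightarrow> stack ps qs \<inter> layer (int j) = block (int j) (ps ! j) (qs ! j)"
  unfolding stack_def layer_def block_def by auto

definition adj_in :: "cell set \<Rightarrow> (cell \<times> cell) set" where
  "adj_in P = {(a, b). a \<in> P \<and> b \<in> P \<and> face_adjacent a b}"

lemma face_connected_alt: "face_connected P \<longleftrightarrow> (\<forall>c\<in>P. \<forall>d\<in>P. (c, d) \<in> (adj_in P)\<^sup>*)"
  by (simp add: face_connected_def adj_in_def)

lemma face_adjacent_sym: "face_adjacent a b \<Longrightarrow> face_adjacent b a"
  by (cases a; cases b) (simp add: abs_minus_commute)

lemma adj_in_rtrancl_sym: "(a, b) \<in> (adj_in P)\<^sup>* \<Longrightarrow> (b, a) \<in> (adj_in P)\<^sup>*"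
proof -
  have "sym (adj_in P)"
    by (auto simp: sym_def adj_in_def intro: face_adjacent_sym)
  thus "(a, b) \<in> (adj_in P)\<^sup>* \<Longrightarrow> (b, a) \<in> (adj_in P)\<^sup>*"
    using sym_rtrancl by (metis symD)
qed

lemma adj_in_mono: "P \<subseteq> Q \<Longrightarrow> (a, b) \<in> (adj_in P)\<^sup>* \<Longrightarrow> (a, b) \<in> (adj_in Q)\<^sup>*"
  by (rule rtrancl_mono[THEN subsetD]) (auto simp: adj_in_def)

lemma face_connected_Un:
  assumes "face_connected A" "face_connected B" "a \<in> A" "b \<in> B" "face_adjacent a b"
  shows "face_connected (A \<union> B)"
proof -
  let ?R = "(adj_in (A \<union> B))\<^sup>*"
  have ab: "(a, b) \<in> ?R"
    using assms by (intro r_into_rtrancl) (simp add: adj_in_def)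
  have A: "(c, a) \<in> ?R" if "c \<in> A" for c
    using assms(1,3) that adj_in_mono[of A "A \<union> B"] unfolding face_connected_alt by blast
  have B: "(c, b) \<in> ?R" if "c \<in> B" for c
    using assms(2,4) that adj_in_mono[of B "A \<union> B"] unfolding face_connected_alt by blast
  have "(c, b) \<in> ?R" if "c \<in> A \<union> B" for c
    using that A B ab by (meson UnE rtrancl_trans)
  thus ?thesis
    unfolding face_connected_alt by (meson adj_in_rtrancl_sym rtrancl_trans)
qed

text \<open>Every cell is joined to the corner \<open>(x, fst p, fst q)\<close>, moving along the second
  coordinate first and then along the third.\<close>

lemma face_connected_block: "face_connected (block x p q)"
proof -
  let ?R = "(adj_in (block x p q))\<^sup>*"
  have y: "y \<in> cells p \<longrightarrow> z \<in> cells q \<longrightarrow> ((x, fst p, z), (x, y, z)) \<in> ?R" if "fst p \<le> y" for y z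
    using that
  proof (induction y rule: int_ge_induct)
    case (step y)
    show ?case
    proof (intro impI)
      assume *: "y + 1 \<in> cells p" "z \<in> cells q"
      hence "((x, y, z), (x, y + 1, z)) \<in> adj_in (block x p q)"
        using step.hyps by (auto simp: adj_in_def block_def cells_def)
      thus "((x, fst p, z), (x, y + 1, z)) \<in> ?R"
        using step * by (auto simp: cells_def intro: rtrancl_into_rtrancl)
    qed
  qed auto
  have z: "z \<in> cells q \<longrightarrow> fst p \<in> cells p \<longrightarrow> ((x, fst p, fst q), (x, fst p, z)) \<in> ?R" if "fst q \<le> z" for z
    using that
  proof (induction z rule: int_ge_induct)
    case (step z)
    show ?case
    proof (intro impI)
      assume *: "z + 1 \<in> cells q" "fst p \<in> cells p"
      hence "((x, fst p, z), (x, fst p, z + 1)) \<in> adj_in (block x p q)"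
        using step.hyps by (auto simp: adj_in_def block_def cells_def)
      thus "((x, fst p, fst q), (x, fst p, z + 1)) \<in> ?R"
        using step * by (auto simp: cells_def intro: rtrancl_into_rtrancl)
    qed
  qed auto
  have "((x, fst p, fst q), c) \<in> ?R" if "c \<in> block x p q" for c
  proof -
    obtain u v where c: "c = (x, u, v)" "u \<in> cells p" "v \<in> cells q"
      using \<open>c \<in> block x p q\<close> by (auto simp: block_def)
    hence "((x, fst p, fst q), (x, fst p, v)) \<in> ?R" "((x, fst p, v), (x, u, v)) \<in> ?R"
      using y[of u v] z[of v] by (auto simp: cells_def)
    thus ?thesis
      unfolding c by (rule rtrancl_trans)
  qed
  thus ?thesis
    unfolding face_connected_alt by (meson adj_in_rtrancl_sym rtrancl_trans)
qed

text \<open>If both sides of two consecutive plateaus overlap, then the plateaus contain two cells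
  that differ only by one step in the first coordinate; hence the layers can be attached one by
  one.\<close>

lemma face_connected_stack:
  assumes "chain ps" "chain qs" "length qs = length ps"
  shows "face_connected (stack ps qs)"
proof -
  have "face_connected (\<Union>j<n. block (int j) (ps ! j) (qs ! j))" if "n \<le> length ps" for n
    using that
  proof (induction n)
    case 0
    show ?case by (simp add: face_connected_def)
  next
    case (Suc n)
    show ?case
    proof (cases n)
      case 0
      thus ?thesis by (simp add: lessThan_Suc face_connected_block)
    next
      case (Suc m)
      have lt: "Suc m < length ps"
        using Suc Suc.prems by simp
      then obtain y z where yz: "y \<in> cells (ps ! m)" "y \<in> cells (ps ! n)"
          "z \<in> cells (qs ! m)" "z \<in> cells (qs ! n)"
        using chain_nth_meets[OF assms(1), of m] chain_nth_meets[OF assms(2), of m] assms(3) Suc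
        by (auto simp: meets_def)
      have "face_connected ((\<Union>j<n. block (int j) (ps ! j) (qs ! j)) \<union> block (int n) (ps ! n) (qs ! n))"
      proof (rule face_connected_Un)
        show "(int m, y, z) \<in> (\<Union>j<n. block (int j) (ps ! j) (qs ! j))"
          using yz Suc by (auto simp: block_def)
        show "(int n, y, z) \<in> block (int n) (ps ! n) (qs ! n)"
          using yz by (auto simp: block_def)
        show "face_adjacent (int m, y, z) (int n, y, z)"
          using Suc by simp
        show "face_connected (\<Union>j<n. block (int j) (ps ! j) (qs ! j))"
          using Suc.IH Suc.prems by simp
      qed (rule face_connected_block)
      thus ?thesis by (simp add: lessThan_Suc Un_commute)
    qed
  qed
  thus ?thesis unfolding stack_def by simp
qed

lemma plateau_block:
  assumes "fst p \<le> snd p" "fst q \<le> snd q"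
  shows "plateau (block x p q)"
proof -
  have ne: "cells p \<noteq> {}" "cells q \<noteq> {}"
    using assms by (auto simp: cells_def)
  hence "fst ` block x p q = {x}"
    by (simp add: block_def fst_image_times)
  hence "width (block x p q) = 1"
    by (simp add: width_def)
  thus ?thesis
    using ne face_connected_block[of x p q] finite_block[of x p q]
    unfolding plateau_def stratum_def polycube_def by (simp add: block_def cells_def) blast
qed

lemma fst_stack:
  assumes "chain ps" "chain qs" "length qs = length ps"
  shows "fst ` stack ps qs = {0..<int (length ps)}"
proof -
  have "fst ` block (int j) (ps ! j) (qs ! j) = {int j}" if "j < length ps" for j
    using chain_nth_le[OF assms(1) that] chain_nth_le[OF assms(2)] that assms(3)
    by (auto simp: block_def cells_def fst_image_times)
  hence "fst ` stack ps qs = int ` {..<length ps}"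
    unfolding stack_def by (auto simp: image_UN)
  thus ?thesis by (simp add: image_int_atLeastLessThan lessThan_atLeast0)
qed

lemma plateau_polycube_stack:
  assumes "chain ps" "chain qs" "length qs = length ps" "ps \<noteq> []"
  shows "plateau_polycube (stack ps qs)"
proof -
  have "stack ps qs \<noteq> {}"
    using fst_stack[OF assms(1-3)] assms(4) by auto
  hence "polycube (stack ps qs)"
    using assms by (simp add: polycube_def finite_stack face_connected_stack)
  moreover have "plateau (stack ps qs \<inter> layer x)" if "stack ps qs \<inter> layer x \<noteq> {}" for x
  proof -
    from that obtain c where "c \<in> stack ps qs" "fst c = x"
      by (auto simp: layer_def)
    hence "x \<in> {0..<int (length ps)}"
      using fst_stack[OF assms(1-3)] by (metis imageI)
    then obtain j where "x = int j" "j < length ps"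
      by (metis atLeastLessThan_iff nonneg_int_cases of_nat_less_iff)
    thus ?thesis
      using assms by (auto simp: stack_layer intro!: plateau_block chain_nth_le)
  qed
  ultimately show ?thesis
    by (auto simp: plateau_polycube_def strata_def)
qed

lemma width_stack:
  assumes "chain ps" "chain qs" "length qs = length ps" "ps \<noteq> []"
  shows "width (stack ps qs) = length ps"
proof -
  have "length ps > 0"
    using assms(4) by simp
  hence "Max {0..<int (length ps)} = int (length ps) - 1" "Min {0..<int (length ps)} = 0"
    by (intro Max_eqI Min_eqI; auto)+
  thus ?thesis
    unfolding width_def fst_stack[OF assms(1-3)] by simp
qed

lemma sum_card_cells:
  assumes "chain ps"
  shows "(\<Sum>j<length ps. card (cells (ps ! j))) = length ps + excess ps"
proof -
  have "card (cells (ps ! j)) = 1 + nat (snd (ps ! j) - fst (ps ! j))" if "j < length ps" for j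
    using chain_nth_le[OF assms that] by (simp add: cells_def)
  hence "(\<Sum>j<length ps. card (cells (ps ! j))) =
      (\<Sum>j<length ps. 1 + nat (snd (ps ! j) - fst (ps ! j)))"
    by simp
  also have "\<dots> = length ps + excess ps"
    unfolding sum.distrib by (simp add: excess_def sum_list_sum_nth atLeast0LessThan)
  finally show ?thesis .
qed

text \<open>The two projections see the two chains separately: the one that forgets the third
  coordinate shows in column \<open>j\<close> exactly the \<open>j\<close>-th interval of \<open>ps\<close>, and
  likewise for \<open>qs\<close>.\<close>

lemma lateral_area_stack:
  assumes "chain ps" "chain qs" "length qs = length ps"
  shows "lateral_area (stack ps qs) = 2 * length ps + excess ps + excess qs"
proof -
  have *: "card (\<Union>j<n. {int j} \<times> cells (rs ! j)) = (\<Sum>j<n. card (cells (rs ! j)))" for n rs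
    by (subst card_UN_disjoint) (auto simp: cells_def card_cartesian_product)
  have ne: "cells (ps ! j) \<noteq> {}" "cells (qs ! j) \<noteq> {}" if "j < length ps" for j
    using chain_nth_le[OF assms(1)] chain_nth_le[OF assms(2)] that assms(3)
    by (auto simp: cells_def)
  have "(\<lambda>(x, y, z). (x, y)) ` block (int j) (ps ! j) (qs ! j) = {int j} \<times> cells (ps ! j)"
    if "j < length ps" for j
    using ne(2)[OF that] by (force simp: block_def)
  hence 1: "(\<lambda>(x, y, z). (x, y)) ` stack ps qs = (\<Union>j<length ps. {int j} \<times> cells (ps ! j))"
    unfolding stack_def image_UN by simp
  have "(\<lambda>(x, y, z). (x, z)) ` block (int j) (ps ! j) (qs ! j) = {int j} \<times> cells (qs ! j)"
    if "j < length ps" for j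
    using ne(1)[OF that] by (force simp: block_def)
  hence 2: "(\<lambda>(x, y, z). (x, z)) ` stack ps qs = (\<Union>j<length ps. {int j} \<times> cells (qs ! j))"
    unfolding stack_def image_UN by simp
  show ?thesis
    unfolding lateral_area_def 1 2 *
    using sum_card_cells[OF assms(1)] sum_card_cells[OF assms(2)] assms(3) by simp
qed

section \<open>Every plateau polycube is a translated stack\<close>

text \<open>A path of cells changes the first coordinate by at most one at a time, and when it does,
  the other two coordinates stay the same. This discrete intermediate value argument yields both
  that no layer between the extreme ones is empty and that consecutive plateaus overlap.\<close>

lemma rtrancl_crosses_layer:
  assumes "(c, d) \<in> (adj_in P)\<^sup>*" "fst c \<le> x" "x < fst d"
  shows "\<exists>y z. (x, y, z) \<in> P \<and> (x + 1, y, z) \<in> P"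
  using assms
proof (induction rule: rtrancl_induct)
  case (step d e)
  show ?case
  proof (cases "x < fst d")
    case False
    obtain a y z a' y' z' where de: "d = (a, y, z)" "e = (a', y', z')"
      by (metis prod.collapse)
    hence "\<bar>a - a'\<bar> + \<bar>y - y'\<bar> + \<bar>z - z'\<bar> = 1" "x < a'" "a \<le> x"
      using step.hyps(2) step.prems False by (simp_all add: adj_in_def)
    hence "a = x \<and> a' = x + 1 \<and> y' = y \<and> z' = z"
      by arith
    thus ?thesis
      using step.hyps(2) de by (auto simp: adj_in_def)
  qed (use step in auto)
qed simp

lemma plateau_blockE:
  assumes "plateau S" "S \<subseteq> layer x"
  obtains p q where "fst p \<le> snd p" "fst q \<le> snd q" "S = block x p q"
proof -
  from assms(1) obtain x' a b c d where S: "S = {x'} \<times> {a..b} \<times> {c..d}" and "S \<noteq> {}"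
    unfolding plateau_def stratum_def polycube_def by metis
  hence "a \<le> b" "c \<le> d" by auto
  moreover have "x' = x"
    using S assms(2) calculation by (force simp: layer_def)
  ultimately show ?thesis
    using that[of "(a, b)" "(c, d)"] S by (simp add: block_def cells_def)
qed

lemma plateau_polycube_layers:
  assumes "plateau_polycube P"
  obtains p q m where
    "width P > 0"
    "\<And>j. j < width P \<Longrightarrow> fst (p j) \<le> snd (p j) \<and> fst (q j) \<le> snd (q j)"
    "\<And>j. Suc j < width P \<Longrightarrow> meets (p j) (p (Suc j)) \<and> meets (q j) (q (Suc j))"
    "P = (\<Union>j<width P. block (m + int j) (p j) (q j))"
proof -
  from assms have P: "finite P" "P \<noteq> {}" "face_connected P"
    by (auto simp: plateau_polycube_def polycube_def)
  define m where "m = Min (fst ` P)"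
  define M where "M = Max (fst ` P)"
  obtain c where c: "c \<in> P" "fst c = m"
    using Min_in[of "fst ` P"] P unfolding m_def by fastforce
  obtain d where d: "d \<in> P" "fst d = M"
    using Max_in[of "fst ` P"] P unfolding M_def by fastforce
  have bounds: "m \<le> fst e" "fst e \<le> M" if "e \<in> P" for e
    using that P by (auto simp: m_def M_def)
  have mM: "m \<le> M"
    using bounds[OF c(1)] c by simp
  have w: "int (width P) = M + 1 - m"
    using mM by (simp add: width_def m_def M_def)
  \<comment> \<open>A path from \<open>c\<close> in the first layer to \<open>d\<close> in the last one passes from each layer to the next.\<close>
  have cross: "\<exists>y z. (x, y, z) \<in> P \<and> (x + 1, y, z) \<in> P" if "m \<le> x" "x < M" for x
    using rtrancl_crosses_layer[of c d P x] P(3) c d that by (auto simp: face_connected_alt)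
  have "P \<inter> layer (m + int j) \<noteq> {}" if "j < width P" for j
  proof (cases "m + int j = M")
    case True
    thus ?thesis using d by (auto simp: layer_def)
  next
    case False
    hence "m + int j < M" using that w by linarith
    thus ?thesis using cross[of "m + int j"] by (auto simp: layer_def)
  qed
  hence "plateau (P \<inter> layer (m + int j))" if "j < width P" for j
    using that assms by (auto simp: plateau_polycube_def strata_def)
  hence "\<exists>r. fst (fst r) \<le> snd (fst r) \<and> fst (snd r) \<le> snd (snd r) \<and>
      P \<inter> layer (m + int j) = block (m + int j) (fst r) (snd r)" if "j < width P" for j
    using that by (metis plateau_blockE inf_le2 fst_conv snd_conv)
  then obtain r where r: "\<And>j. j < width P \<Longrightarrow>
      fst (fst (r j)) \<le> snd (fst (r j)) \<and> fst (snd (r j)) \<le> snd (snd (r j)) \<and>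
      P \<inter> layer (m + int j) = block (m + int j) (fst (r j)) (snd (r j))"
    by metis
  have mem: "(m + int j, y, z) \<in> P \<longleftrightarrow> y \<in> cells (fst (r j)) \<and> z \<in> cells (snd (r j))"
    if "j < width P" for j y z
  proof -
    have "(m + int j, y, z) \<in> P \<longleftrightarrow> (m + int j, y, z) \<in> P \<inter> layer (m + int j)"
      by (simp add: layer_def)
    thus ?thesis using r[OF that] by (auto simp: block_def)
  qed
  show ?thesis
  proof (rule that[of "\<lambda>j. fst (r j)" "\<lambda>j. snd (r j)" m])
    show "width P > 0" using w mM by linarith
  next
    fix j assume j: "Suc j < width P"
    hence "m + int j < M" using w by linarith
    then obtain y z where "(m + int j, y, z) \<in> P" "(m + int (Suc j), y, z) \<in> P"
      using cross[of "m + int j"] by (auto simp: add_ac)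
    thus "meets (fst (r j)) (fst (r (Suc j))) \<and> meets (snd (r j)) (snd (r (Suc j)))"
      using mem[of j] mem[of "Suc j"] j by (auto simp: meets_def)
  next
    show "P = (\<Union>j<width P. block (m + int j) (fst (r j)) (snd (r j)))"
    proof (intro equalityI subsetI)
      fix e assume e: "e \<in> P"
      define j where "j = nat (fst e - m)"
      have "m + int j = fst e" "j < width P"
        using bounds[OF e] w by (auto simp: j_def)
      moreover from this have "e \<in> P \<inter> layer (m + int j)"
        using e by (simp add: layer_def)
      hence "e \<in> block (m + int j) (fst (r j)) (snd (r j))"
        using r[OF \<open>j < width P\<close>] by blast
      ultimately show "e \<in> (\<Union>j<width P. block (m + int j) (fst (r j)) (snd (r j)))"
        by (intro UN_I[of j]) simp_all
    qed (use r in blast)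
  qed (use r in auto)
qed

definition shift_interval :: "int \<Rightarrow> interval \<Rightarrow> interval" where
  "shift_interval a p = (fst p - a, snd p - a)"

lemma mem_cells_shift: "y \<in> cells (shift_interval a p) \<longleftrightarrow> y + a \<in> cells p"
  by (auto simp: cells_def shift_interval_def)

lemma meets_shift: "meets p q \<Longrightarrow> meets (shift_interval a p) (shift_interval a q)"
proof -
  assume "meets p q"
  then obtain y where "y \<in> cells p" "y \<in> cells q" by (auto simp: meets_def)
  hence "y - a \<in> cells (shift_interval a p) \<inter> cells (shift_interval a q)"
    by (simp add: mem_cells_shift)
  thus ?thesis by (auto simp: meets_def)
qed

lemma chain_shifted_upt:
  assumes "\<And>j. j < k \<Longrightarrow> fst (p j) \<le> snd (p j)" "\<And>j. Suc j < k \<Longrightarrow> meets (p j) (p (Suc j))"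
  shows "chain (map (\<lambda>j. shift_interval a (p j)) [0..<k])"
  unfolding chain_def
  using assms by (auto simp: successively_conv_nth meets_shift) (auto simp: shift_interval_def)

text \<open>The translation vector is chosen to put the first layer at 0 and the corner of the last
  plateau at \<open>(0, 0)\<close>, which is the normalization of \<open>anchored_chains\<close>.\<close>

lemma plateau_polycube_translate_stack:
  assumes "plateau_polycube P"
  obtains ps qs v where "chain ps" "chain qs" "length ps = width P" "length qs = width P"
    "ps \<noteq> []" "fst (last ps) = 0" "fst (last qs) = 0" "P = (+) v ` stack ps qs"
proof -
  obtain p q m where w: "width P > 0"
    and le: "\<And>j. j < width P \<Longrightarrow> fst (p j) \<le> snd (p j) \<and> fst (q j) \<le> snd (q j)"
    and meets: "\<And>j. Suc j < width P \<Longrightarrow> meets (p j) (p (Suc j)) \<and> meets (q j) (q (Suc j))"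
    and P: "P = (\<Union>j<width P. block (m + int j) (p j) (q j))"
    using plateau_polycube_layers[OF assms] by blast
  define k where "k = width P"
  define b where "b = fst (p (k - 1))"
  define c where "c = fst (q (k - 1))"
  define ps where "ps = map (\<lambda>j. shift_interval b (p j)) [0..<k]"
  define qs where "qs = map (\<lambda>j. shift_interval c (q j)) [0..<k]"
  have [simp]: "length ps = k" "length qs = k"
    by (simp_all add: ps_def qs_def)
  have "P = (+) (m, b, c) ` stack ps qs"
  proof -
    have "(+) (m, b, c) ` block (int j) (ps ! j) (qs ! j) = block (m + int j) (p j) (q j)"
      if "j < k" for j
    proof (intro equalityI subsetI)
      fix e assume "e \<in> block (m + int j) (p j) (q j)"
      then obtain y z where "e = (m + int j, y, z)" "y \<in> cells (p j)" "z \<in> cells (q j)"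
        by (auto simp: block_def)
      thus "e \<in> (+) (m, b, c) ` block (int j) (ps ! j) (qs ! j)"
        using that by (intro image_eqI[of _ _ "(int j, y - b, z - c)"])
          (auto simp: block_def ps_def qs_def mem_cells_shift)
    qed (use that in \<open>auto simp: block_def ps_def qs_def mem_cells_shift add.commute\<close>)
    thus ?thesis
      unfolding stack_def image_UN by (subst P) (simp add: k_def)
  qed
  moreover have "chain ps" "chain qs"
    unfolding ps_def qs_def k_def using le meets by (auto intro!: chain_shifted_upt)
  moreover have "ps \<noteq> []"
    using w \<open>length ps = k\<close> unfolding k_def by force
  moreover have "fst (last ps) = 0" "fst (last qs) = 0"
    using w by (auto simp: ps_def qs_def last_map k_def b_def c_def shift_interval_def)
  ultimately show ?thesis
    using that[of ps qs "(m, b, c)"] by (simp add: k_def)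
qed

section \<open>Uniqueness of the stack\<close>

lemma shifted_intervals_eq:
  assumes "fst p \<le> snd p" "\<And>y. y \<in> cells p \<longleftrightarrow> b + y \<in> cells p'"
  shows "fst p' = b + fst p \<and> snd p' = b + snd p"
proof -
  have "cells p' = {b + fst p..b + snd p}"
  proof (rule set_eqI)
    fix y
    show "y \<in> cells p' \<longleftrightarrow> y \<in> {b + fst p..b + snd p}"
      using assms(2)[of "y - b"] by (auto simp: cells_def)
  qed
  thus ?thesis
    using assms(1) Icc_eq_Icc[of "fst p'" "snd p'" "b + fst p" "b + snd p"]
    by (simp add: cells_def)
qed

text \<open>The projection to the first coordinate forces a translation between normalized stacks to
  preserve the layers. Comparing the plateaus layer by layer, the shift of each side is the same in
  every layer, and it vanishes in the last one by normalization.\<close>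

lemma stack_translate_inj:
  assumes ps: "chain ps" "chain qs" "length qs = length ps" "fst (last ps) = 0" "fst (last qs) = 0"
    and ps': "chain ps'" "chain qs'" "length qs' = length ps'" "fst (last ps') = 0" "fst (last qs') = 0"
    and "ps \<noteq> []" and len: "length ps' = length ps"
    and eq: "stack ps' qs' = (+) v ` stack ps qs"
  shows "ps' = ps \<and> qs' = qs"
proof -
  obtain a b c where v: "v = (a, b, c)" by (cases v)
  define k where "k = length ps"
  have k: "k > 0" and l: "length ps = k" "length qs = k" "length ps' = k" "length qs' = k"
    using assms by (auto simp: k_def)
  have "{0..<int k} = fst ` (+) v ` stack ps qs"
    using fst_stack[OF ps'(1-3)] eq l by simp
  also have "\<dots> = (+) a ` fst ` stack ps qs"
    by (force simp: v image_image)
  also have "\<dots> = {a..<a + int k}"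
    using fst_stack[OF ps(1-3)] l by (simp add: add.commute)
  finally have a: "a = 0"
    using k by (simp add: atLeastLessThan_eq_iff)
  have mem: "(x, y, z) \<in> stack ps qs \<longleftrightarrow> (x, b + y, c + z) \<in> stack ps' qs'" for x y z
    unfolding eq v a by (force simp: image_iff)
  have *: "(fst (ps' ! j) = b + fst (ps ! j) \<and> snd (ps' ! j) = b + snd (ps ! j)) \<and>
      (fst (qs' ! j) = c + fst (qs ! j) \<and> snd (qs' ! j) = c + snd (qs ! j))" if "j < k" for j
  proof -
    have le: "fst (ps ! j) \<le> snd (ps ! j)" "fst (qs ! j) \<le> snd (qs ! j)"
      using ps that l by (auto intro: chain_nth_le)
    have **: "y \<in> cells (ps ! j) \<and> z \<in> cells (qs ! j) \<longleftrightarrow>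
        b + y \<in> cells (ps' ! j) \<and> c + z \<in> cells (qs' ! j)" for y z
      using mem[of "int j" y z] that l by (auto simp: mem_stack)
    have f: "fst (ps ! j) \<in> cells (ps ! j)" "fst (qs ! j) \<in> cells (qs ! j)"
      using le by (auto simp: cells_def)
    show ?thesis
      using f ** le by (intro conjI[OF shifted_intervals_eq shifted_intervals_eq]) blast+
  qed
  \<comment> \<open>By normalization, the shifts vanish in the last layer, hence everywhere.\<close>
  have "last ps = ps ! (k - 1)" "last qs = qs ! (k - 1)"
    "last ps' = ps' ! (k - 1)" "last qs' = qs' ! (k - 1)"
    using l k by (auto simp: last_conv_nth simp flip: length_greater_0_conv)
  hence "b = 0" "c = 0"
    using *[of "k - 1"] k ps(4,5) ps'(4,5) by auto
  thus ?thesis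
    using * l by (auto intro!: nth_equalityI prod_eqI)
qed

lemma equiv_translates: "equiv UNIV translates"
proof (rule equivI)
  have "P = (+) 0 ` P" for P :: "cell set"
    by simp
  hence "(P, P) \<in> translates" for P
    unfolding translates_def by blast
  thus "refl translates"
    by (auto simp: refl_on_def)
  show "sym translates"
  proof (rule symI)
    fix P Q assume "(P, Q) \<in> translates"
    then obtain v where "Q = (+) v ` P" by (auto simp: translates_def)
    hence "P = (+) (- v) ` Q" by (simp add: image_image)
    thus "(Q, P) \<in> translates" unfolding translates_def by blast
  qed
  show "trans translates"
  proof (rule transI)
    fix P Q R assume "(P, Q) \<in> translates" "(Q, R) \<in> translates"
    then obtain v w where "Q = (+) v ` P" "R = (+) w ` Q" by (auto simp: translates_def)
    hence "R = (+) (w + v) ` P" by (simp add: image_image add.assoc)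
    thus "(P, R) \<in> translates" unfolding translates_def by blast
  qed
qed auto

lemma lateral_area_translate: "lateral_area ((+) v ` P) = lateral_area P"
proof -
  obtain a b c where v: "v = (a, b, c)" by (cases v)
  have "(\<lambda>(x, y, z). (x, y)) ` (+) v ` P = (+) (a, b) ` (\<lambda>(x, y, z). (x, y)) ` P"
    by (force simp: v image_image)
  moreover have "(\<lambda>(x, y, z). (x, z)) ` (+) v ` P = (+) (a, c) ` (\<lambda>(x, y, z). (x, z)) ` P"
    by (force simp: v image_image)
  ultimately show ?thesis
    by (simp add: lateral_area_def card_image)
qed

section \<open>Counting chains of intervals\<close>

text \<open>Fixing the last interval, rather than the first, to start at 0 removes the freedom of
  translation in a way that is compatible with recursion on lists: adding a new head leaves the
  anchor untouched.\<close>

definition anchored_chains :: "nat \<Rightarrow> nat \<Rightarrow> interval list set" where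
  "anchored_chains k n = {ps. length ps = k \<and> chain ps \<and> fst (last ps) = 0 \<and> excess ps = n}"

text \<open>The number of ways to extend a chain at its head depends on the length of the head, which
  is therefore recorded as \<open>b\<close>.\<close>

definition headed_chains :: "nat \<Rightarrow> nat \<Rightarrow> nat \<Rightarrow> interval list set" where
  "headed_chains k n b = {ps \<in> anchored_chains k n. nat (snd (hd ps) - fst (hd ps)) = b}"

lemma headed_chains_1: "headed_chains (Suc 0) n b = (if n = b then {[(0, int b)]} else {})"
  by (auto simp: headed_chains_def anchored_chains_def chain_def excess_def length_Suc_conv)

lemma headed_chains_empty: "n < b \<Longrightarrow> 0 < k \<Longrightarrow> headed_chains k n b = {}"
  by (auto simp: headed_chains_def anchored_chains_def excess_def neq_Nil_conv length_greater_0_conv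
      simp flip: length_greater_0_conv)

text \<open>A new head of excess \<open>b\<close> meets the old head, of excess \<open>b'\<close>, for
  exactly \<open>b + b' + 1\<close> positions \<open>a\<close> of its left end.\<close>

lemma headed_chains_Suc:
  assumes "0 < k" "b \<le> n"
  shows "headed_chains (Suc k) n b =
    (\<Union>b'\<le>n - b. (\<lambda>(ps, a). (a, a + int b) # ps) `
       (SIGMA ps : headed_chains k (n - b) b'. {fst (hd ps) - int b..fst (hd ps) + int b'}))"
  (is "?A = ?B")
proof (intro set_eqI iffI)
  fix rs assume rs: "rs \<in> ?A"
  then obtain p q ps where [simp]: "rs = p # q # ps"
    using assms by (cases rs; cases "tl rs") (auto simp: headed_chains_def anchored_chains_def)
  from rs have *: "fst p \<le> snd p" "fst q \<le> snd q" "meets p q" "nat (snd p - fst p) = b"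
    "q # ps \<in> headed_chains k (n - b) (nat (snd q - fst q))"
    by (auto simp: headed_chains_def anchored_chains_def chain_def excess_def)
  have "nat (snd q - fst q) \<le> n - b"
    using *(5) headed_chains_empty[OF _ assms(1)] by (metis empty_iff not_less)
  moreover have "rs = (\<lambda>(ps, a). (a, a + int b) # ps) (q # ps, fst p)"
    using * by (cases p) auto
  moreover have "fst p \<in> {fst q - int b..fst q + int (nat (snd q - fst q))}"
    using * by (auto simp: meets_iff)
  ultimately show "rs \<in> ?B"
    using *(5) by (intro UN_I[of "nat (snd q - fst q)"] image_eqI[of _ _ "(q # ps, fst p)"]) auto
next
  fix rs assume "rs \<in> ?B"
  then obtain b' ps a where [simp]: "rs = (a, a + int b) # ps"
    and ps: "ps \<in> headed_chains k (n - b) b'"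
    and a: "a \<in> {fst (hd ps) - int b..fst (hd ps) + int b'}"
    by auto
  from ps assms(1) obtain q qs where [simp]: "ps = q # qs"
    by (cases ps) (auto simp: headed_chains_def anchored_chains_def)
  from ps have "fst q \<le> snd q" "snd q = fst q + int b'"
    by (auto simp: headed_chains_def anchored_chains_def chain_def)
  thus "rs \<in> ?A"
    using ps a assms
    by (auto simp: headed_chains_def anchored_chains_def chain_def excess_def meets_iff)
qed

lemma finite_headed_chains: "0 < k \<Longrightarrow> finite (headed_chains k n b)"
proof (induction k arbitrary: n b rule: nat_induct_non_zero)
  case 1
  show ?case by (simp add: headed_chains_1)
next
  case (Suc k)
  show ?case
  proof (cases "b \<le> n")
    case True
    thus ?thesis using Suc by (subst headed_chains_Suc) auto
  next
    case False
    thus ?thesis by (simp add: headed_chains_empty)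
  qed
qed

lemma headed_chains_disjoint: "b \<noteq> b' \<Longrightarrow> headed_chains k n b \<inter> headed_chains k n b' = {}"
  by (auto simp: headed_chains_def)

lemma card_headed_chains_Suc:
  assumes "0 < k" "b \<le> n"
  shows "card (headed_chains (Suc k) n b) =
    (\<Sum>b'\<le>n - b. card (headed_chains k (n - b) b') * (b + b' + 1))"
proof -
  let ?f = "\<lambda>(ps, a). (a, a + int b) # ps"
  let ?S = "\<lambda>b'. SIGMA ps : headed_chains k (n - b) b'. {fst (hd ps) - int b..fst (hd ps) + int b'}"
  have inj: "inj_on ?f A" for A
    by (auto simp: inj_on_def)
  have "card (headed_chains (Suc k) n b) = (\<Sum>b'\<le>n - b. card (?f ` ?S b'))"
    unfolding headed_chains_Suc[OF assms]
    using assms headed_chains_disjoint[of _ _ k "n - b"]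
    by (intro card_UN_disjoint) (auto simp: finite_headed_chains)
  also have "\<dots> = (\<Sum>b'\<le>n - b. card (?S b'))"
    by (intro sum.cong refl card_image inj)
  also have "\<dots> = (\<Sum>b'\<le>n - b. card (headed_chains k (n - b) b') * (b + b' + 1))"
  proof (intro sum.cong refl)
    fix b'
    have "nat (a + int b' + 1 - (a - int b)) = b + b' + 1" for a
      by simp
    thus "card (?S b') = card (headed_chains k (n - b) b') * (b + b' + 1)"
      using assms
      by (subst card_SigmaI) (auto simp: finite_headed_chains nat_add_distrib algebra_simps)
  qed
  finally show ?thesis .
qed

lemma anchored_chains_eq_UN: 
  assumes "0 < k"
  shows "anchored_chains k n = (\<Union>b\<le>n. headed_chains k n b)"
proof -
  have "ps \<in> headed_chains k n (nat (snd (hd ps) - fst (hd ps)))" if "ps \<in> anchored_chains k n" for ps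
    using that by (simp add: headed_chains_def)
  moreover from this have "nat (snd (hd ps) - fst (hd ps)) \<le> n" if "ps \<in> anchored_chains k n" for ps
    using that headed_chains_empty[OF _ assms] by (metis empty_iff not_less)
  ultimately show ?thesis
    by (auto simp: headed_chains_def)
qed

lemma finite_anchored_chains: "0 < k \<Longrightarrow> finite (anchored_chains k n)"
  by (simp add: anchored_chains_eq_UN finite_headed_chains)

lemma anchored_chains_disjoint: "n \<noteq> n' \<Longrightarrow> anchored_chains k n \<inter> anchored_chains k n' = {}"
  by (auto simp: anchored_chains_def)

lemma card_anchored_chains:
  assumes "0 < k"
  shows "card (anchored_chains k n) = (\<Sum>b\<le>n. card (headed_chains k n b))"
  unfolding anchored_chains_eq_UN[OF assms]
  using assms headed_chains_disjoint[of _ _ k n]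
  by (intro card_UN_disjoint) (auto simp: finite_headed_chains)

section \<open>Generating functions of chains and plateau polycubes\<close>

definition chain_fps :: "nat \<Rightarrow> real fps" where
  "chain_fps k = Abs_fps (\<lambda>n. real (card (anchored_chains k n)))"

text \<open>Each translation class of plateau polycubes contains exactly one stack of a pair of
  anchored chains, and the excess of the lateral area over its minimum \<open>2 * k\<close> is shared
  out between the two chains. The two chains are otherwise independent, so that the count is a
  Cauchy product.\<close>

lemma num_plateau_polycubes_eq_fps:
  assumes "0 < k"
  shows "real (num_plateau_polycubes k (2 * k + i)) = fps_nth (chain_fps k ^ 2) i"
proof -
  define A where "A = {P. plateau_polycube P \<and> width P = k \<and> lateral_area P = 2 * k + i}"
  define C where "C = (\<Union>n\<le>i. anchored_chains k n \<times> anchored_chains k (i - n))"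
  let ?f = "\<lambda>(ps, qs). translates `` {stack ps qs}"
  have C: "(ps, qs) \<in> C \<longleftrightarrow> chain ps \<and> chain qs \<and> length ps = k \<and> length qs = k \<and>
      fst (last ps) = 0 \<and> fst (last qs) = 0 \<and> excess ps + excess qs = i" for ps qs
    by (auto simp: C_def anchored_chains_def)
  have "bij_betw ?f C (A // translates)"
    unfolding bij_betw_def
  proof (intro conjI inj_onI equalityI image_subsetI subsetI)
    fix x x' assume "x \<in> C" "x' \<in> C" "?f x = ?f x'"
    moreover obtain ps qs ps' qs' where x: "x = (ps, qs)" "x' = (ps', qs')"
      by (cases x; cases x')
    ultimately have *: "(ps, qs) \<in> C" "(ps', qs') \<in> C"
      "translates `` {stack ps qs} = translates `` {stack ps' qs'}"
      by auto
    hence "(stack ps qs, stack ps' qs') \<in> translates"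
      using equiv_translates by (simp add: eq_equiv_class_iff)
    then obtain v where "stack ps' qs' = (+) v ` stack ps qs"
      by (auto simp: translates_def)
    thus "x = x'"
      using *(1,2) assms stack_translate_inj[of ps qs ps' qs' v] by (auto simp: C x)
  next
    fix x assume "x \<in> C"
    moreover obtain ps qs where x: "x = (ps, qs)"
      by (cases x)
    ultimately have "stack ps qs \<in> A"
      using assms unfolding x C A_def
      by (auto simp: width_stack lateral_area_stack intro!: plateau_polycube_stack)
    thus "?f x \<in> A // translates"
      by (simp add: x quotientI)
  next
    fix X assume "X \<in> A // translates"
    then obtain P where P: "P \<in> A" and X: "X = translates `` {P}"
      by (auto elim: quotientE)
    obtain ps qs v where *: "chain ps" "chain qs" "length ps = width P" "length qs = width P"
      "ps \<noteq> []" "fst (last ps) = 0" "fst (last qs) = 0" and v: "P = (+) v ` stack ps qs"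
      using P plateau_polycube_translate_stack[of P] unfolding A_def by blast
    have "lateral_area (stack ps qs) = 2 * k + i"
      using P v by (simp add: A_def lateral_area_translate)
    hence "(ps, qs) \<in> C"
      using P * by (auto simp: C A_def lateral_area_stack)
    moreover have "X = ?f (ps, qs)"
    proof -
      have "(stack ps qs, P) \<in> translates"
        using v unfolding translates_def by blast
      thus ?thesis
        using equiv_class_eq[OF equiv_translates, of "stack ps qs" P] X by simp
    qed
    ultimately show "X \<in> ?f ` C"
      by blast
  qed
  hence "num_plateau_polycubes k (2 * k + i) = card C"
    unfolding num_plateau_polycubes_def A_def by (simp add: bij_betw_same_card)
  also have "card C = (\<Sum>n\<le>i. card (anchored_chains k n) * card (anchored_chains k (i - n)))"
    unfolding C_def using assms anchored_chains_disjoint[of _ _ k]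
    by (subst card_UN_disjoint)
      (auto simp: finite_anchored_chains card_cartesian_product Times_Int_Times)
  finally show ?thesis
    by (simp add: power2_eq_square fps_mult_nth chain_fps_def atMost_atLeast0)
qed

text \<open>Together with \<open>chain_fps\<close> this is enough for a closed linear recurrence, since the
  number \<open>b + b' + 1\<close> of extensions is affine in the excess \<open>b'\<close> of the old head.\<close>

definition head_fps :: "nat \<Rightarrow> real fps" where
  "head_fps k = Abs_fps (\<lambda>n. \<Sum>b\<le>n. real b * real (card (headed_chains k n b)))"

text \<open>The geometric series, that is \<open>1 / (1 - X)\<close>; all the coefficients of the recurrence
  are powers of it up to a factor.\<close>

definition geom :: "real fps" where
  "geom = Abs_fps (\<lambda>_. 1)"

lemma geom_inverse: "(1 - fps_X) * geom = 1"
  by (rule fps_ext) (auto simp: geom_def algebra_simps)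

lemma geom_power2: "geom ^ 2 = Abs_fps (\<lambda>b. real b + 1)"
  by (rule fps_ext) (simp add: geom_def power2_eq_square fps_mult_nth)

lemma geom_power3: "2 * fps_X * geom ^ 3 = Abs_fps (\<lambda>b. real b * (real b + 1))"
proof -
  have "(1 - fps_X) * Abs_fps (\<lambda>b. real b * (real b + 1)) = 2 * fps_X * geom ^ 2"
  proof (rule fps_ext)
    fix n
    show "fps_nth ((1 - fps_X) * Abs_fps (\<lambda>b. real b * (real b + 1))) n =
        fps_nth (2 * fps_X * geom ^ 2) n"
      unfolding geom_power2 by (cases n) (auto simp: algebra_simps numeral_fps_const)
  qed
  hence "((1 - fps_X) * geom) * Abs_fps (\<lambda>b. real b * (real b + 1)) = 2 * fps_X * geom ^ 3"
    by (simp add: power3_eq_cube power2_eq_square mult_ac)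
  thus ?thesis
    unfolding geom_inverse by simp
qed

lemma X_geom_power2: "fps_X * geom ^ 2 = Abs_fps real"
proof (rule fps_ext)
  fix n
  show "fps_nth (fps_X * geom ^ 2) n = fps_nth (Abs_fps real) n"
    unfolding geom_power2 by (cases n) (auto simp: algebra_simps)
qed

lemma card_headed_chains_Suc_fps:
  assumes "0 < k" "b \<le> n"
  shows "real (card (headed_chains (Suc k) n b)) =
    (real b + 1) * fps_nth (chain_fps k) (n - b) + fps_nth (head_fps k) (n - b)"
  using assms by (simp add: card_headed_chains_Suc chain_fps_def head_fps_def card_anchored_chains
      sum_distrib_left sum_distrib_right algebra_simps sum.distrib)

lemma chain_fps_1: "chain_fps (Suc 0) = geom"
  by (rule fps_ext) (simp add: chain_fps_def geom_def card_anchored_chains headed_chains_1 if_distrib cong: if_cong)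

lemma head_fps_1: "head_fps (Suc 0) = fps_X * geom ^ 2"
  unfolding X_geom_power2
  by (rule fps_ext) (simp add: head_fps_def headed_chains_1 if_distrib cong: if_cong)

lemma chain_fps_Suc:
  assumes "0 < k"
  shows "chain_fps (Suc k) = geom ^ 2 * chain_fps k + geom * head_fps k"
proof (rule fps_ext)
  fix n
  have "fps_nth (chain_fps (Suc k)) n = 
     (\<Sum>b\<le>n. (real b + 1) * fps_nth (chain_fps k) (n - b) + fps_nth (head_fps k) (n - b))"
    using assms by (auto simp: chain_fps_def[of "Suc k"] card_anchored_chains card_headed_chains_Suc_fps
      intro!: sum.cong)
  thus "fps_nth (chain_fps (Suc k)) n = fps_nth (geom ^ 2 * chain_fps k + geom * head_fps k) n"
    unfolding geom_power2 unfolding geom_def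
    by (simp add: fps_mult_nth sum.distrib atMost_atLeast0)
qed

lemma head_fps_Suc:
  assumes "0 < k"
  shows "head_fps (Suc k) = 2 * fps_X * geom ^ 3 * chain_fps k + fps_X * geom ^ 2 * head_fps k"
proof (rule fps_ext)
  fix n
  have "fps_nth (head_fps (Suc k)) n = 
     (\<Sum>b\<le>n. real b * ((real b + 1) * fps_nth (chain_fps k) (n - b) + fps_nth (head_fps k) (n - b)))"
    using assms by (auto simp: head_fps_def[of "Suc k"] card_headed_chains_Suc_fps
      intro!: sum.cong)
  thus "fps_nth (head_fps (Suc k)) n =
      fps_nth (2 * fps_X * geom ^ 3 * chain_fps k + fps_X * geom ^ 2 * head_fps k) n"
    unfolding geom_power3 X_geom_power2
    by (simp add: fps_mult_nth sum.distrib atMost_atLeast0 ring_distribs mult.assoc)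
qed

section \<open>Solution of the recurrence\<close>

text \<open>Up to the factor \<open>geom ^ 2\<close> this is the square root of the discriminant of the
  characteristic polynomial of the recurrence. It is a power series because the constant
  coefficient \<open>1\<close> has a square root; the first argument of \<open>fps_radical\<close> chooses
  the root of that coefficient.\<close>

definition disc_root :: "real fps" where
  "disc_root = fps_radical (\<lambda>_ _. 1) 2 (1 + 6 * fps_X + fps_X ^ 2)"

lemma disc_root_power2: "disc_root ^ 2 = 1 + 6 * fps_X + fps_X ^ 2"
  using power_radical[of "1 + 6 * fps_X + fps_X ^ 2 :: real fps" "\<lambda>_ _. 1" 1]
  by (simp add: disc_root_def numeral_2_eq_2)

lemma disc_root_nth_0: "fps_nth disc_root 0 = 1"
  by (simp add: disc_root_def)

lemma disc_root_nth_1: "fps_nth disc_root 1 = 3"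
proof -
  have "fps_nth (disc_root ^ 2) 1 = 6"
    unfolding disc_root_power2 by (simp add: numeral_fps_const power2_eq_square)
  thus ?thesis
    by (simp add: power2_eq_square fps_mult_nth disc_root_nth_0)
qed

text \<open>The two eigenvalues of the matrix of the recurrence in \<open>chain_fps_Suc\<close> and
  \<open>head_fps_Suc\<close>, by the quadratic formula.\<close>

definition root_plus :: "real fps" where
  "root_plus = fps_const (1/2) * (1 + fps_X + disc_root) * geom ^ 2"

definition root_minus :: "real fps" where
  "root_minus = fps_const (1/2) * (1 + fps_X - disc_root) * geom ^ 2"

lemma fps_half: "2 * fps_const (1/2 :: real) = 1"
  by (simp add: numeral_fps_const)

lemma root_sum: "root_plus + root_minus = (1 + fps_X) * geom ^ 2"
  unfolding root_plus_def root_minus_def using fps_half by algebra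

lemma root_prod: "root_plus * root_minus = - fps_X * geom ^ 4"
proof -
  \<comment> \<open>The factor 4 clears the two halves.\<close>
  have "4 * (root_plus * root_minus) = 4 * (- fps_X * geom ^ 4)"
    unfolding root_plus_def root_minus_def using fps_half disc_root_power2 by algebra
  thus ?thesis by (metis mult_left_cancel zero_neq_numeral)
qed

lemma root_diff: "root_plus - root_minus = disc_root * geom ^ 2"
  unfolding root_plus_def root_minus_def using fps_half by algebra

text \<open>The theorem of Cayley and Hamilton for the two-by-two matrix of the recurrence.\<close>

lemma chain_fps_Suc_Suc:
  assumes "0 < k"
  shows "chain_fps (Suc (Suc k)) =
    (root_plus + root_minus) * chain_fps (Suc k) - root_plus * root_minus * chain_fps k"
  unfolding root_sum root_prod
  using chain_fps_Suc[OF assms] head_fps_Suc[OF assms] chain_fps_Suc[of "Suc k"]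
  by (simp add: algebra_simps eval_nat_numeral)

text \<open>The Binet-like solution of the recurrence of order two. The common factor on the left is
  \<open>(root_plus - root_minus) / geom\<close>, where \<open>geom\<close> is the value at length 1.\<close>

lemma chain_fps_closed:
  "disc_root * geom * chain_fps (Suc k) = root_plus ^ Suc k - root_minus ^ Suc k"
proof (induction k rule: induct_nat_012)
  case 0
  show ?case using root_diff by (simp add: chain_fps_1 power2_eq_square mult_ac)
next
  case 1
  have "chain_fps (Suc (Suc 0)) = (root_plus + root_minus) * geom"
    unfolding root_sum
    using chain_fps_Suc[of "Suc 0"] by (simp add: chain_fps_1 head_fps_1 algebra_simps)
  thus ?case using root_diff
    by simp algebra
next
  case (ge2 k)
  let ?f = "\<lambda>k. disc_root * geom * chain_fps k"
  have "?f (Suc (Suc (Suc k))) =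
      (root_plus + root_minus) * ?f (Suc (Suc k)) - root_plus * root_minus * ?f (Suc k)"
    by (simp add: chain_fps_Suc_Suc algebra_simps)
  thus ?case
    unfolding ge2 by (simp add: algebra_simps)
qed

lemma root_plus_nth: "fps_nth root_plus 0 = 1" "fps_nth root_plus 1 = 4"
  unfolding root_plus_def geom_power2
  by (simp_all add: fps_mult_nth disc_root_nth_0 disc_root_nth_1[unfolded One_nat_def])

text \<open>This is why the second eigenvalue is invisible in low degrees: its \<open>k\<close>-th power is
  divisible by \<open>X ^ k\<close>.\<close>

lemma root_minus_nth_0: "fps_nth root_minus 0 = 0"
  unfolding root_minus_def geom_power2
  by (simp add: disc_root_nth_0)

text \<open>In the square of the closed form, every term other than \<open>root_plus ^ (2 * k)\<close> has the
  factor \<open>root_minus ^ k\<close>, hence does not reach the coefficients below \<open>k\<close>. This is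
  where the bound \<open>i < k\<close> comes from.\<close>

lemma chain_fps_power2_nth:
  assumes "i < k"
  shows "fps_nth (chain_fps k ^ 2) i =
    fps_nth (inverse ((disc_root * geom) ^ 2) * (root_plus ^ 2) ^ k) i"
proof -
  define M where "M = fps_shift 1 root_minus"
  have M: "root_minus = fps_X * M"
    using root_minus_nth_0 by (intro fps_ext) (simp add: M_def)
  define D where "D = (disc_root * geom) ^ 2"
  have D0: "fps_nth D 0 \<noteq> 0"
    by (simp add: D_def geom_def disc_root_nth_0 fps_power_zeroth)
  \<comment> \<open>\<open>Z\<close> collects all terms divisible by \<open>root_minus ^ k = X ^ k * M ^ k\<close>.\<close>
  define Z where "Z = M ^ k * (root_minus ^ k - 2 * root_plus ^ k)"
  have closed: "disc_root * geom * chain_fps k = root_plus ^ k - root_minus ^ k"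
    using chain_fps_closed[of "k - 1"] assms by simp
  have square_power: "(root_plus ^ 2) ^ k = (root_plus ^ k) ^ 2"
    by (simp add: mult.commute flip: power_mult)
  have "D * chain_fps k ^ 2 = (root_plus ^ k - root_minus ^ k) ^ 2"
    unfolding D_def closed[symmetric] by (simp flip: power_mult_distrib)
  also have "\<dots> = (root_plus ^ 2) ^ k + root_minus ^ k * (root_minus ^ k - 2 * root_plus ^ k)"
    unfolding square_power by algebra
  also have "\<dots> = (root_plus ^ 2) ^ k + fps_X ^ k * Z"
    using arg_cong[OF M, of "\<lambda>r. r ^ k"] by (simp add: Z_def power_mult_distrib mult.assoc)
  finally have D_eq: "D * chain_fps k ^ 2 = (root_plus ^ 2) ^ k + fps_X ^ k * Z" .
  hence "inverse D * (D * chain_fps k ^ 2) =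
      inverse D * (root_plus ^ 2) ^ k + fps_X ^ k * (inverse D * Z)"
    by (simp add: algebra_simps)
  moreover have "inverse D * (D * chain_fps k ^ 2) = chain_fps k ^ 2"
    using inverse_mult_eq_1[OF D0] by (simp flip: mult.assoc)
  ultimately have "chain_fps k ^ 2 =
      inverse D * (root_plus ^ 2) ^ k + fps_X ^ k * (inverse D * Z)"
    by simp
  thus ?thesis
    using assms by (simp add: fps_X_power_mult_nth D_def)
qed

section \<open>Coefficients of powers as polynomials in the exponent\<close>

definition binomial_poly :: "nat \<Rightarrow> real poly" where
  "binomial_poly j = smult (1 / fact j) (\<Prod>l<j. [:- real l, 1:])"

lemma poly_binomial_poly: "poly (binomial_poly j) (real k) = real (k choose j)"
  by (simp add: binomial_poly_def poly_prod binomial_gbinomial gbinomial_prod_rev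
      lessThan_atLeast0)

lemma degree_binomial_poly: "degree (binomial_poly j) = j"
  by (simp add: binomial_poly_def degree_prod_eq_sum_degree)

lemma lead_coeff_binomial_poly: "lead_coeff (binomial_poly j) = 1 / fact j"
proof -
  have "lead_coeff (\<Prod>l<j. [:- real l, 1:]) = 1"
    by (simp add: lead_coeff_prod)
  thus ?thesis unfolding binomial_poly_def by (simp only: lead_coeff_smult)
qed

text \<open>Write \<open>L = 1 + X * M\<close> and expand \<open>L ^ k\<close> by the binomial theorem: only the
  terms with \<open>j \<le> i\<close> contribute to the coefficient of \<open>X ^ i\<close>, the \<open>j\<close>-th
  one being a multiple of \<open>k choose j\<close>. The term \<open>j = i\<close>, which involves only constant
  coefficients, determines the leading coefficient.\<close>

lemma fps_power_coeff_polynomial: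
  fixes L E :: "real fps"
  assumes "fps_nth L 0 = 1" "fps_nth L 1 \<noteq> 0" "fps_nth E 0 = 1"
  shows "\<exists>p. degree p = i \<and> lead_coeff p = fps_nth L 1 ^ i / fact i \<and>
    (\<forall>k. fps_nth (E * L ^ k) i = poly p (real k))"
proof -
  define c where "c = fps_nth L 1"
  define M where "M = fps_shift 1 (L - 1)"
  have L: "L = fps_X * M + 1"
    using assms(1) by (intro fps_ext) (auto simp: M_def)
  have M0: "fps_nth M 0 = c"
    by (simp add: M_def c_def)
  define e where "e j = fps_nth (E * M ^ j) (i - j)" for j
  define p where "p = (\<Sum>j\<le>i. smult (e j) (binomial_poly j))"
  have ei: "e i = c ^ i"
    using assms(3) M0 by (simp add: e_def fps_power_zeroth)
  have coeff: "coeff p i = c ^ i / fact i"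
  proof -
    have "coeff p i = (\<Sum>j\<le>i. e j * coeff (binomial_poly j) i)"
      by (simp add: p_def coeff_sum)
    also have "\<dots> = (\<Sum>j\<le>i. if j = i then c ^ i / fact i else 0)"
    proof (intro sum.cong refl)
      fix j assume "j \<in> {..i}"
      thus "e j * coeff (binomial_poly j) i = (if j = i then c ^ i / fact i else 0)"
        using lead_coeff_binomial_poly[of i] ei
        by (auto simp: degree_binomial_poly coeff_eq_0)
    qed
    finally show ?thesis by simp
  qed
  have "degree p \<le> i"
    unfolding p_def
    by (intro degree_sum_le) (auto intro: order.trans[OF degree_smult_le] simp: degree_binomial_poly)
  moreover have "coeff p i \<noteq> 0"
    using coeff assms(2) by (simp add: c_def)
  ultimately have deg: "degree p = i"
    using le_degree by (metis antisym)
  have "fps_nth (E * L ^ k) i = poly p (real k)" for k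
  proof -
    have "E * L ^ k = (\<Sum>j\<le>k. of_nat (k choose j) * (fps_X ^ j * (E * M ^ j)))"
      unfolding L binomial_ring by (simp add: sum_distrib_left power_mult_distrib mult_ac)
    hence "fps_nth (E * L ^ k) i =
        (\<Sum>j\<le>k. real (k choose j) * (if i < j then 0 else e j))"
      by (simp add: fps_sum_nth fps_X_power_mult_nth e_def cong: if_cong flip: fps_of_nat)
    also have "\<dots> = (\<Sum>j\<le>i. real (k choose j) * e j)"
      by (rule sum.mono_neutral_cong) (auto simp: binomial_eq_0)
    also have "\<dots> = poly p (real k)"
      by (simp add: p_def poly_sum poly_binomial_poly mult.commute)
    finally show ?thesis .
  qed
  thus ?thesis
    using deg coeff by (intro exI[of _ p]) (auto simp: c_def)
qed

text \<open>The number 8 is the linear coefficient of \<open>root_plus ^ 2\<close>, where \<open>root_plus\<close>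
  starts with \<open>1 + 4 * X\<close>.\<close>

lemma chain_fps_power2_polynomial:
  "\<exists>p. degree p = i \<and> lead_coeff p = 8 ^ i / fact i \<and>
    (\<forall>k. i < k \<longrightarrow> fps_nth (chain_fps k ^ 2) i = poly p (real k))"
proof -
  have "fps_nth (root_plus ^ 2) 0 = 1" and 8: "fps_nth (root_plus ^ 2) 1 = 8"
    using root_plus_nth by (simp_all add: power2_eq_square fps_mult_nth)
  moreover have "fps_nth (inverse ((disc_root * geom) ^ 2)) 0 = 1"
    by (simp add: geom_def disc_root_nth_0 fps_power_zeroth)
  ultimately show ?thesis
    using fps_power_coeff_polynomial[of "root_plus ^ 2" "inverse ((disc_root * geom) ^ 2)" i]
    by (auto simp: chain_fps_power2_nth)
qed

theorem theorem5p4: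
  fixes i :: nat
  shows "\<exists>p :: real poly. degree p = i \<and> lead_coeff p = 8 ^ i / fact i \<and>
    (\<forall>k :: nat. k \<ge> i + 1 \<longrightarrow> real (num_plateau_polycubes k (2 * k + i)) = poly p (real k))"
proof -
  obtain p where "degree p = i" "lead_coeff p = 8 ^ i / fact i"
    and "\<And>k. i < k \<Longrightarrow> fps_nth (chain_fps k ^ 2) i = poly p (real k)"
    using chain_fps_power2_polynomial[of i] by blast
  thus ?thesis
    by (intro exI[of _ p]) (simp add: num_plateau_polycubes_eq_fps)
qed

end
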